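(* Let $X=\{1,2,3,4,5,6\}$, $C=\{X\}$, and let $M$ be the family of all $A\subseteq X$ such that either $|A|\ge 4$, or $|A|=3$ and $\sum_{i\in A}i$ is even. Then $\langle X,C,M\rangle$ is a weak qualitative probability structure, but there is no probability measure $P$ on the power set of $X$ such that, for all $A\subseteq X$, (i) $P(A)=1$ if and only if $A\in C$, and (ii) $P(A)>\frac12$ if and only if $A\in M$.
   Context: Let $X$ be a nonempty set and $C,M$ families of subsets of $X$. For $A\subseteq X$ write $A^c=X\setminus A$. Call $A$ certain if $A\in C$; more likely than not if $A\in M$; impossible if $A^c\in C$; less likely than not if $A^c\in M$; as likely as not if none of $A\in C$, $A\in M$, $A^c\in C$, $A^c\in M$ holds. The triple $\langle X,C,M\rangle$ is a weak qualitative probability structure (in the sense of Suppes) if, for all $A,B\subseteq X$: (1) $X$ is certain; (2) if $A\subseteq B$ and $A$ is certain, then $B$ is certain; (3) if $A\subseteq B$ and $A$ is more likely than not, then $B$ is more likely than not; (4) if $A\subsetneq B$ and $A$ is as likely as not, then $B$ is more likely than not; (5) if $A$ is certain, then $A^c$ is impossible; (6) if $A$ is more likely than not, then $A^c$ is less likely than not. *)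

theory Defs
  imports "HOL-Probability.Probability"
begin

definition certain :: "'a set \<Rightarrow> 'a set set \<Rightarrow> 'a set set \<Rightarrow> 'a set \<Rightarrow> bool" where
  "certain X C M A \<longleftrightarrow> A \<in> C"

definition more_likely :: "'a set \<Rightarrow> 'a set set \<Rightarrow> 'a set set \<Rightarrow> 'a set \<Rightarrow> bool" where
  "more_likely X C M A \<longleftrightarrow> A \<in> M"

definition impossible :: "'a set \<Rightarrow> 'a set set \<Rightarrow> 'a set set \<Rightarrow> 'a set \<Rightarrow> bool" where
  "impossible X C M A \<longleftrightarrow> X - A \<in> C"

definition less_likely :: "'a set \<Rightarrow> 'a set set \<Rightarrow> 'a set set \<Rightarrow> 'a set \<Rightarrow> bool" where
  "less_likely X C M A \<longleftrightarrow> X - A \<in> M"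

definition as_likely :: "'a set \<Rightarrow> 'a set set \<Rightarrow> 'a set set \<Rightarrow> 'a set \<Rightarrow> bool" where
  "as_likely X C M A \<longleftrightarrow> A \<notin> C \<and> A \<notin> M \<and> X - A \<notin> C \<and> X - A \<notin> M"

definition weak_qualitative_probability_structure ::
    "'a set \<Rightarrow> 'a set set \<Rightarrow> 'a set set \<Rightarrow> bool" where
  "weak_qualitative_probability_structure X C M \<longleftrightarrow>
     X \<noteq> {} \<and> C \<subseteq> Pow X \<and> M \<subseteq> Pow X \<and>
     certain X C M X \<and>
     (\<forall>A B. A \<subseteq> X \<longrightarrow> B \<subseteq> X \<longrightarrow> A \<subseteq> B \<longrightarrow> certain X C M A \<longrightarrow> certain X C M B) \<and>
     (\<forall>A B. A \<subseteq> X \<longrightarrow> B \<subseteq> X \<longrightarrow> A \<subseteq> B \<longrightarrow> more_likely X C M A \<longrightarrow> more_likely X C M B) \<and>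
     (\<forall>A B. A \<subseteq> X \<longrightarrow> B \<subseteq> X \<longrightarrow> A \<subset> B \<longrightarrow> as_likely X C M A \<longrightarrow> more_likely X C M B) \<and>
     (\<forall>A. A \<subseteq> X \<longrightarrow> certain X C M A \<longrightarrow> impossible X C M (X - A)) \<and>
     (\<forall>A. A \<subseteq> X \<longrightarrow> more_likely X C M A \<longrightarrow> less_likely X C M (X - A))"

end

(* Since 1 + ... + 6 = 21 is odd, exactly one of a triple and its complement has even sum, so no set
   is as likely as not. The four triples {2,4,6}, {1,2,3}, {3,4,5}, {1,5,6} have even sum and cover
   each point exactly twice: their probabilities would each exceed 1/2 but add up to 2. *)
theory Submission
  imports Defs
begin

theorem mainTheorem6:
  fixes X :: "nat set" and C M :: "nat set set"
  assumes "X = {1, 2, 3, 4, 5, 6}"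
    and "C = {X}"
    and "M = {A. A \<subseteq> X \<and> (card A \<ge> 4 \<or> (card A = 3 \<and> even (\<Sum>i\<in>A. i)))}"
  shows "weak_qualitative_probability_structure X C M \<and>
    \<not> (\<exists>P :: nat measure. prob_space P \<and> space P = X \<and> sets P = Pow X \<and>
        (\<forall>A. A \<subseteq> X \<longrightarrow>
          (measure P A = 1 \<longleftrightarrow> A \<in> C) \<and> (measure P A > 1 / 2 \<longleftrightarrow> A \<in> M)))"
proof
  have fin: "finite X" and card: "card X = 6" and sum: "(\<Sum>i\<in>X. i) = 21"
    using assms(1) by simp_all
  have mono: "B \<in> M" if "A \<subseteq> B" "B \<subseteq> X" "A \<in> M" for A B
  proof (cases "A = B")
    case False
    \<comment> \<open>A proper superset of a set with at least three elements has at least four, so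
      it lies in \<open>M\<close> whatever the parity of its sum.\<close>
    then have "card A < card B"
      using that fin by (meson finite_subset psubsetI psubset_card_mono)
    then show ?thesis using that unfolding assms(3) by auto
  qed (use that in simp)
  have decided: "A \<in> M \<or> X - A \<in> M" if A: "A \<subseteq> X" for A
  proof -
    have "finite A" using A fin finite_subset by blast
    then have "card (X - A) = 6 - card A" using A card by (simp add: card_Diff_subset)
    moreover have "(\<Sum>i\<in>X - A. i) + (\<Sum>i\<in>A. i) = 21"
      using sum.subset_diff[OF A fin, of "\<lambda>i. i"] sum by simp
    then have "even (\<Sum>i\<in>X - A. i) \<or> even (\<Sum>i\<in>A. i)"
      by (metis even_add odd_numeral)
    \<comment> \<open>If \<open>A\<close> has at least four elements, it lies in \<open>M\<close>
      itself; if it has at most two, its complement has at least four. Only for triples, whose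
      complements are again triples, does parity decide.\<close>
    ultimately show ?thesis unfolding assms(3)
      by (cases "card A \<ge> 4"; cases "card A = 3") (use A in auto)
  qed
  show "weak_qualitative_probability_structure X C M"
    unfolding weak_qualitative_probability_structure_def certain_def more_likely_def
      impossible_def less_likely_def as_likely_def
  proof (intro conjI)
    show "X \<noteq> {}" using assms(1) by simp
    show "C \<subseteq> Pow X" "X \<in> C" using assms(2) by auto
    show "M \<subseteq> Pow X" using assms(3) by blast
    show "\<forall>A B. A \<subseteq> X \<longrightarrow> B \<subseteq> X \<longrightarrow> A \<subseteq> B \<longrightarrow> A \<in> C \<longrightarrow> B \<in> C"
      using assms(2) by blast
    show "\<forall>A B. A \<subseteq> X \<longrightarrow> B \<subseteq> X \<longrightarrow> A \<subseteq> B \<longrightarrow> A \<in> M \<longrightarrow> B \<in> M"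
      using mono by blast
    \<comment> \<open>Vacuously true: by \<open>decided\<close> no \<open>A\<close> satisfies the
      premise.\<close>
    show "\<forall>A B. A \<subseteq> X \<longrightarrow> B \<subseteq> X \<longrightarrow> A \<subset> B \<longrightarrow>
        A \<notin> C \<and> A \<notin> M \<and> X - A \<notin> C \<and> X - A \<notin> M \<longrightarrow> B \<in> M"
      using decided by blast
  \<comment> \<open>The last two conditions reduce to \<open>X - (X - A) = A\<close>.\<close>
  qed (simp_all add: double_diff)
  show "\<not> (\<exists>P :: nat measure. prob_space P \<and> space P = X \<and> sets P = Pow X \<and>
        (\<forall>A. A \<subseteq> X \<longrightarrow>
          (measure P A = 1 \<longleftrightarrow> A \<in> C) \<and> (measure P A > 1 / 2 \<longleftrightarrow> A \<in> M)))"
  proof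
    assume "\<exists>P :: nat measure. prob_space P \<and> space P = X \<and> sets P = Pow X \<and>
        (\<forall>A. A \<subseteq> X \<longrightarrow>
          (measure P A = 1 \<longleftrightarrow> A \<in> C) \<and> (measure P A > 1 / 2 \<longleftrightarrow> A \<in> M))"
    then obtain P :: "nat measure" where P: "prob_space P" "space P = X" "sets P = Pow X"
      and P_iff: "\<forall>A. A \<subseteq> X \<longrightarrow>
          (measure P A = 1 \<longleftrightarrow> A \<in> C) \<and> (measure P A > 1 / 2 \<longleftrightarrow> A \<in> M)"
      by (elim exE conjE)
    have half: "measure P A > 1 / 2 \<longleftrightarrow> A \<in> M" if "A \<subseteq> X" for A
      using P_iff[rule_format, OF that] by (rule conjunct2)
    interpret prob_space P by fact
    have eq: "measure P A = (\<Sum>i\<in>A. measure P {i})" if "A \<subseteq> X" for A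
      using that P(3) fin finite_subset[OF that fin]
      by (intro finite_measure_eq_sum_singleton) auto
    \<comment> \<open>Finite additivity turns membership of a triple in \<open>M\<close> into a
      linear inequality between the six point masses \<open>measure P {i}\<close>, so that the
      contradiction becomes one of linear arithmetic.\<close>
    have gt: "(\<Sum>i\<in>A. measure P {i}) > 1 / 2"
      if "A \<subseteq> X" "card A = 3" "even (\<Sum>i\<in>A. i)" for A
      using half[OF that(1)] eq[OF that(1)] that assms(3) by auto
    have "(\<Sum>i\<in>X. measure P {i}) = 1" using eq[of X] prob_space P(2) by simp
    moreover have "(\<Sum>i\<in>{2, 4, 6}. measure P {i}) > 1 / 2"
      by (rule gt) (auto simp: assms(1))
    moreover have "(\<Sum>i\<in>{1, 2, 3}. measure P {i}) > 1 / 2"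
      by (rule gt) (auto simp: assms(1))
    moreover have "(\<Sum>i\<in>{3, 4, 5}. measure P {i}) > 1 / 2"
      by (rule gt) (auto simp: assms(1))
    moreover have "(\<Sum>i\<in>{1, 5, 6}. measure P {i}) > 1 / 2"
      by (rule gt) (auto simp: assms(1))
    \<comment> \<open>Each point mass occurs in exactly two of the four sums, so adding the strict
      inequalities makes twice the total mass, which is 2, exceed 4 * (1/2) = 2.\<close>
    ultimately show False unfolding assms(1) by simp
  qed
qed

end
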